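(* Let $G$ be a minimal $(3,3)$-Ramsey graph with $\omega(G) \leq 4$. Then $\delta(G) \geq 5$. Moreover, if $v \in V(G)$ and $d(v) = 5$, then $G(v)$ is isomorphic to $N_{5.i}$ for some $i \in \{1,2,3\}$.
   Context: All graphs are finite, undirected, without loops or multiple edges. $\omega(G)$ is the clique number, $\delta(G)$ the minimum degree, $d(v)$ the degree of $v$, and $G(v)$ the subgraph of $G$ induced by the set of neighbors of $v$. A graph $G$ is a $(3,3)$-Ramsey graph, written $G \rightarrow (3,3)$, if every coloring of the edges of $G$ with two colors contains a monochromatic triangle. $G$ is a minimal $(3,3)$-Ramsey graph if $G \rightarrow (3,3)$ and no proper subgraph $H$ of $G$ satisfies $H \rightarrow (3,3)$. For vertex-disjoint graphs $G_1,G_2$, $G_1+G_2$ denotes their join (all edges between $G_1$ and $G_2$ are added). The 5-vertex graphs are $N_{5.1} = K_1 + 2K_2$ (two triangles sharing exactly one vertex), $N_{5.2} = K_1 + P_4$ with $P_4$ the path on $4$ vertices, and $N_{5.3} = K_1 + C_4$ with $C_4$ the cycle on $4$ vertices. *)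

theory Defs
  imports Main "HOL-Library.Ramsey"
begin

record 'a ugraph =
  verts :: "'a set"
  edges :: "'a set set"

definition simple_graph :: "'a ugraph \<Rightarrow> bool" where
  "simple_graph G \<longleftrightarrow> finite (verts G) \<and> edges G \<subseteq> [verts G]\<^bsup>2\<^esup>"

definition subgraph :: "'a ugraph \<Rightarrow> 'a ugraph \<Rightarrow> bool" where
  "subgraph H G \<longleftrightarrow> simple_graph H \<and> verts H \<subseteq> verts G \<and> edges H \<subseteq> edges G"

definition induced :: "'a ugraph \<Rightarrow> 'a set \<Rightarrow> 'a ugraph" where
  "induced G W = \<lparr>verts = W \<inter> verts G, edges = {e \<in> edges G. e \<subseteq> W}\<rparr>"

definition neighbours :: "'a ugraph \<Rightarrow> 'a \<Rightarrow> 'a set" where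
  "neighbours G v = {u \<in> verts G. {u, v} \<in> edges G}"

definition degree :: "'a ugraph \<Rightarrow> 'a \<Rightarrow> nat" where
  "degree G v = card (neighbours G v)"

(* Meaningful only when the vertex set is finite and nonempty. *)
definition min_degree :: "'a ugraph \<Rightarrow> nat" where
  "min_degree G = Min (degree G ` verts G)"

definition clique_number :: "'a ugraph \<Rightarrow> nat" where
  "clique_number G = Max {card C | C. C \<subseteq> verts G \<and> clique C (edges G)}"

definition neighbourhood_graph :: "'a ugraph \<Rightarrow> 'a \<Rightarrow> 'a ugraph" where
  "neighbourhood_graph G v = induced G (neighbours G v)"

(* G -> (3,3).  A 2-colouring is a boolean function on all sets of vertices; only its
   values on the edges of G matter. *)
definition ramsey33 :: "'a ugraph \<Rightarrow> bool" where
  "ramsey33 G \<longleftrightarrow>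
    (\<forall>c :: 'a set \<Rightarrow> bool.
      \<exists>T \<in> [verts G]\<^bsup>3\<^esup>. clique T (edges G) \<and> (\<exists>b. \<forall>e \<in> [T]\<^bsup>2\<^esup>. c e = b))"

definition minimal_ramsey33 :: "'a ugraph \<Rightarrow> bool" where
  "minimal_ramsey33 G \<longleftrightarrow>
    ramsey33 G \<and> (\<forall>H. subgraph H G \<and> H \<noteq> G \<longrightarrow> \<not> ramsey33 H)"

definition graph_iso :: "'a ugraph \<Rightarrow> 'b ugraph \<Rightarrow> bool" where
  "graph_iso G H \<longleftrightarrow>
    (\<exists>f. bij_betw f (verts G) (verts H) \<and>
      (\<forall>u \<in> verts G. \<forall>v \<in> verts G. {u, v} \<in> edges G \<longleftrightarrow> {f u, f v} \<in> edges H))"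

(* The sum type makes the two vertex sets disjoint. *)
definition disjoint_union :: "'a ugraph \<Rightarrow> 'b ugraph \<Rightarrow> ('a + 'b) ugraph" where
  "disjoint_union G H =
    \<lparr>verts = verts G <+> verts H,
     edges = (`) Inl ` edges G \<union> (`) Inr ` edges H\<rparr>"

definition join :: "'a ugraph \<Rightarrow> 'b ugraph \<Rightarrow> ('a + 'b) ugraph" where
  "join G H =
    \<lparr>verts = verts G <+> verts H,
     edges = (`) Inl ` edges G \<union> (`) Inr ` edges H
       \<union> {{Inl u, Inr v} | u v. u \<in> verts G \<and> v \<in> verts H}\<rparr>"

definition complete_graph :: "nat \<Rightarrow> nat ugraph" where
  "complete_graph n = \<lparr>verts = {..<n}, edges = [{..<n}]\<^bsup>2\<^esup>\<rparr>"

definition path_graph :: "nat \<Rightarrow> nat ugraph" where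
  "path_graph n = \<lparr>verts = {..<n}, edges = {{i, Suc i} | i. Suc i < n}\<rparr>"

(* A cycle only for n \<ge> 3. *)
definition cycle_graph :: "nat \<Rightarrow> nat ugraph" where
  "cycle_graph n = \<lparr>verts = {..<n}, edges = {{i, Suc i mod n} | i. i < n}\<rparr>"

definition N5_1 :: "(nat + (nat + nat)) ugraph" where
  "N5_1 = join (complete_graph 1) (disjoint_union (complete_graph 2) (complete_graph 2))"

definition N5_2 :: "(nat + nat) ugraph" where
  "N5_2 = join (complete_graph 1) (path_graph 4)"

definition N5_3 :: "(nat + nat) ugraph" where
  "N5_3 = join (complete_graph 1) (cycle_graph 4)"

end

theory Submission
  imports Defs
begin

text \<open>
  Let \<open>v\<close> be a vertex of \<open>G\<close> with neighbourhood \<open>N\<close>. By minimality \<open>G - v\<close> has a colouring without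
  monochromatic triangle. If \<open>N\<close> splits into an independent set \<open>A\<close> and a set \<open>B\<close> all of whose
  edges have the same colour, then giving the edges from \<open>v\<close> to \<open>A\<close> that colour and the edges from
  \<open>v\<close> to \<open>B\<close> the other one extends the colouring to \<open>G\<close>, a contradiction. In particular \<open>N\<close> cannot
  be split into an independent set and a set that spans at most one edge. Degree at most \<open>4\<close> is
  then impossible. In degree \<open>5\<close> the complement of \<open>G(v)\<close> has no triangle and no \<open>P\<^sub>3 \<union> K\<^sub>2\<close>, and
  it has two disjoint edges since it is not contained in a star (\<open>N\<close> contains no \<open>K\<^sub>4\<close>); so one vertex
  is isolated in it and the other four span \<open>2K\<^sub>2\<close>, \<open>P\<^sub>4\<close> or \<open>C\<^sub>4\<close>.
\<close>

section \<open>Graphs, neighbourhoods and cliques\<close>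

lemma graph_not_loop:
  assumes "simple_graph G"
  shows "{x} \<notin> edges G"
  using assms by (auto simp: simple_graph_def nsets_def)

lemma graph_finite_verts: "simple_graph G \<Longrightarrow> finite (verts G)"
  by (simp add: simple_graph_def)

lemma simple_graph_induced:
  assumes "simple_graph G"
  shows "simple_graph (induced G W)"
  using assms by (auto simp: simple_graph_def induced_def nsets_def)

lemma neighbours_subset: "neighbours G v \<subseteq> verts G"
  by (auto simp: neighbours_def)

lemma neighbours_irrefl:
  assumes "simple_graph G"
  shows "v \<notin> neighbours G v"
  using graph_not_loop[OF assms] by (auto simp: neighbours_def)

lemma card_clique_le_clique_number:
  assumes "simple_graph G" "C \<subseteq> verts G" "clique C (edges G)"
  shows "card C \<le> clique_number G"
proof -
  have "{card C | C. C \<subseteq> verts G \<and> clique C (edges G)} \<subseteq> card ` Pow (verts G)"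
    by auto
  then have "finite {card C | C. C \<subseteq> verts G \<and> clique C (edges G)}"
    by (rule finite_subset) (simp add: graph_finite_verts[OF assms(1)])
  then show ?thesis
    unfolding clique_number_def using assms(2,3) by (intro Max_ge) auto
qed

text \<open>Adjoining \<open>v\<close> enlarges the clique by one; so if the clique number is at
  most 4, no neighbourhood contains a \<open>K_4\<close>.\<close>

lemma card_clique_neighbours:
  assumes "simple_graph G" "v \<in> verts G" "C \<subseteq> neighbours G v" "clique C (edges G)"
  shows "card C < clique_number G"
proof -
  have "finite C" "v \<notin> C"
    using assms(3) neighbours_irrefl[OF assms(1)]
      finite_subset[OF subset_trans[OF assms(3) neighbours_subset]] graph_finite_verts[OF assms(1)]
    by auto
  moreover have "clique (insert v C) (edges G)"
    using assms(3,4) by (auto simp: clique_def neighbours_def insert_commute)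
  moreover have "insert v C \<subseteq> verts G"
    using assms(2,3) neighbours_subset[of G v] by auto
  ultimately show ?thesis
    using card_clique_le_clique_number[OF assms(1), of "insert v C"] by simp
qed

section \<open>Extending a colouring over a deleted vertex\<close>

lemma minimal_ramsey33_delete_vertex:
  assumes "simple_graph G" "minimal_ramsey33 G" "v \<in> verts G"
  obtains c :: "'a set \<Rightarrow> bool"
  where "\<forall>T \<in> [verts G - {v}]\<^bsup>3\<^esup>. clique T (edges G) \<longrightarrow> \<not> (\<exists>b. \<forall>e \<in> [T]\<^bsup>2\<^esup>. c e = b)"
proof -
  let ?H = "induced G (verts G - {v})"
  have "subgraph ?H G"
    using simple_graph_induced[OF assms(1)] by (auto simp: subgraph_def induced_def)
  moreover have "?H \<noteq> G"
  proof
    assume "?H = G"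
    then have "verts ?H = verts G" by simp
    then show False using assms(3) by (auto simp: induced_def)
  qed
  ultimately have "\<not> ramsey33 ?H"
    using assms(2) by (auto simp: minimal_ramsey33_def)
  then obtain c :: "'a set \<Rightarrow> bool" where
    c: "\<not> (\<exists>T \<in> [verts ?H]\<^bsup>3\<^esup>. clique T (edges ?H) \<and> (\<exists>b. \<forall>e \<in> [T]\<^bsup>2\<^esup>. c e = b))"
    unfolding ramsey33_def not_all by (rule exE)
  show thesis
  proof (rule that, intro ballI impI)
    fix T
    assume T: "T \<in> [verts G - {v}]\<^bsup>3\<^esup>" "clique T (edges G)"
    then have "T \<in> [verts ?H]\<^bsup>3\<^esup>" "clique T (edges ?H)"
      by (auto simp: induced_def nsets_def clique_def)
    then show "\<not> (\<exists>b. \<forall>e \<in> [T]\<^bsup>2\<^esup>. c e = b)"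
      using c by metis
  qed
qed

text \<open>A monochromatic triangle of the extended colouring must contain \<open>v\<close>. Its
  edges at \<open>v\<close> agree, so its other two vertices lie on the same side of the split,
  hence outside the independent set \<open>A\<close>; but there their edge has colour
  \<open>b\<close> and the edges at \<open>v\<close> do not.\<close>

lemma no_monochromatic_split:
  fixes c :: "'a set \<Rightarrow> bool"
  assumes ram: "ramsey33 G"
    and c: "\<forall>T \<in> [verts G - {v}]\<^bsup>3\<^esup>. clique T (edges G) \<longrightarrow> \<not> (\<exists>b. \<forall>e \<in> [T]\<^bsup>2\<^esup>. c e = b)"
    and indep: "indep A (edges G)"
    and mono: "\<And>x y. x \<in> neighbours G v - A \<Longrightarrow> y \<in> neighbours G v - A \<Longrightarrow>
                {x, y} \<in> edges G \<Longrightarrow> c {x, y} = b"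
  shows False
proof -
  \<comment> \<open>An edge from \<open>v\<close> to \<open>x\<close> gets colour \<open>b\<close>
    exactly if \<open>x\<close> is in \<open>A\<close>; removing \<open>v\<close> from the
    intersection keeps this right even if \<open>v\<close> is in \<open>A\<close>.\<close>
  define c' where "c' e = (if v \<in> e then (e \<inter> A - {v} \<noteq> {}) = b else c e)" for e
  obtain T b' where T: "T \<in> [verts G]\<^bsup>3\<^esup>" "clique T (edges G)" and b': "\<And>e. e \<in> [T]\<^bsup>2\<^esup> \<Longrightarrow> c' e = b'"
    using ram[unfolded ramsey33_def, THEN spec, of c'] by (elim bexE conjE exE) simp
  show False
  proof (cases "v \<in> T")
    case False
    then have "T \<in> [verts G - {v}]\<^bsup>3\<^esup>"
      using T(1) by (auto simp: nsets_def)
    moreover have "c e = b'" if "e \<in> [T]\<^bsup>2\<^esup>" for e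
    proof -
      have "v \<notin> e" using that False by (auto simp: nsets_def)
      then show ?thesis using b'[OF that] by (simp add: c'_def)
    qed
    ultimately show False
      using c[rule_format, of T] T(2) by simp
  next
    case True
    have "card (T - {v}) = 2"
      using T(1) True by (simp add: nsets_def)
    then obtain x y where "T - {v} = {x, y}" "x \<noteq> y"
      by (auto simp: card_2_iff)
    then have xy: "T = {v, x, y}" "x \<noteq> y" "x \<noteq> v" "y \<noteq> v"
      using True by auto
    then have e: "{v, x} \<in> edges G" "{v, y} \<in> edges G" "{x, y} \<in> edges G"
      using T(2) by (auto simp: clique_def)
    have nb: "x \<in> neighbours G v" "y \<in> neighbours G v"
      using e T(1) xy(1) by (auto simp: neighbours_def nsets_def insert_commute)
    have "{v, x} \<in> [T]\<^bsup>2\<^esup>" "{v, y} \<in> [T]\<^bsup>2\<^esup>" "{x, y} \<in> [T]\<^bsup>2\<^esup>"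
      using xy by auto
    then have "c' {v, x} = b'" "c' {v, y} = b'" "c' {x, y} = b'"
      by (simp_all only: b')
    moreover have "c' {v, x} = ((x \<in> A) = b)" "c' {v, y} = ((y \<in> A) = b)" "c' {x, y} = c {x, y}"
      using xy by (auto simp: c'_def)
    moreover have "x \<notin> A \<or> y \<notin> A"
      using indep e(3) \<open>x \<noteq> y\<close> by (auto simp: indep_def)
    ultimately show False
      using mono[of x y] e(3) nb by auto
  qed
qed

text \<open>At most one edge outside \<open>A\<close> is monochromatic under every colouring, so the
  colouring disappears from the hypotheses. As \<open>e\<close> is an arbitrary set, the edgeless
  case is included.\<close>

lemma minimal_ramsey33_no_split:
  fixes G :: "'a ugraph"
  assumes "simple_graph G" "minimal_ramsey33 G" "v \<in> verts G" "indep A (edges G)"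
    and e: "\<And>x y. x \<in> neighbours G v - A \<Longrightarrow> y \<in> neighbours G v - A \<Longrightarrow>
           {x, y} \<in> edges G \<Longrightarrow> {x, y} = e"
  shows False
proof -
  obtain c :: "'a set \<Rightarrow> bool" where
    c: "\<forall>T \<in> [verts G - {v}]\<^bsup>3\<^esup>. clique T (edges G) \<longrightarrow> \<not> (\<exists>b. \<forall>e \<in> [T]\<^bsup>2\<^esup>. c e = b)"
    by (rule minimal_ramsey33_delete_vertex[OF assms(1-3)])
  have "ramsey33 G"
    using assms(2) by (simp add: minimal_ramsey33_def)
  then show False
    using c assms(4)
  proof (rule no_monochromatic_split)
    fix x y
    assume "x \<in> neighbours G v - A" "y \<in> neighbours G v - A" "{x, y} \<in> edges G"
    then have "{x, y} = e" by (rule e)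
    then show "c {x, y} = c e" by simp
  qed
qed

section \<open>Lower bound on the degree\<close>

text \<open>Two vertices span at most one edge, so an independent set missing at most two neighbours
  would give a forbidden split.\<close>

lemma minimal_ramsey33_indep_neighbours:
  assumes "simple_graph G" "minimal_ramsey33 G" "v \<in> verts G"
    and "A \<subseteq> neighbours G v" "indep A (edges G)"
  shows "card A + 3 \<le> degree G v"
proof (rule ccontr)
  assume "\<not> ?thesis"
  moreover have fin: "finite (neighbours G v)"
    using assms(1) neighbours_subset[of G v] graph_finite_verts by (auto intro: finite_subset)
  ultimately have "card (neighbours G v - A) \<le> 2"
    using assms(4) by (simp add: degree_def card_Diff_subset finite_subset)
  show False
  proof (rule minimal_ramsey33_no_split[OF assms(1-3,5)])
    fix x y
    assume xy: "x \<in> neighbours G v - A" "y \<in> neighbours G v - A" "{x, y} \<in> edges G"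
    show "{x, y} = neighbours G v - A"
    proof (rule card_seteq)
      have "x \<noteq> y" using xy(3) graph_not_loop[OF assms(1)] by auto
      then show "card (neighbours G v - A) \<le> card {x, y}"
        using \<open>card (neighbours G v - A) \<le> 2\<close> by simp
    qed (use fin xy in auto)
  qed
qed

text \<open>A nonadjacent pair of neighbours gives 2 + 3. If there is none, the neighbourhood is a
  clique of at most 3 vertices, yet it is nonempty and a single neighbour already forces degree
  4.\<close>

lemma minimal_ramsey33_degree_ge_5:
  assumes "simple_graph G" "minimal_ramsey33 G" "v \<in> verts G" "clique_number G \<le> 4"
  shows "degree G v \<ge> 5"
proof (cases "clique (neighbours G v) (edges G)")
  case True
  then have "degree G v \<le> 3"
    using card_clique_neighbours[OF assms(1,3) subset_refl] assms(4) by (simp add: degree_def)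
  moreover have "degree G v \<ge> 3"
    using minimal_ramsey33_indep_neighbours[OF assms(1-3), of "{}"] by simp
  ultimately have "neighbours G v \<noteq> {}"
    by (auto simp: degree_def)
  then obtain a where "a \<in> neighbours G v" by blast
  then have "degree G v \<ge> 4"
    using minimal_ramsey33_indep_neighbours[OF assms(1-3), of "{a}"] by (simp add: indep_def)
  then show ?thesis using \<open>degree G v \<le> 3\<close> by simp
next
  case False
  then obtain a b where ab: "a \<in> neighbours G v" "b \<in> neighbours G v" "a \<noteq> b" "{a, b} \<notin> edges G"
    by (auto simp: clique_def)
  then have "indep {a, b} (edges G)"
    by (auto simp: indep_def insert_commute)
  then show ?thesis
    using minimal_ramsey33_indep_neighbours[OF assms(1-3), of "{a, b}"] ab by simp
qed

section \<open>Explicit form of the three graphs and isomorphisms onto them\<close>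

lemma verts_small_graphs:
  "verts (complete_graph 1) = {0}" "verts (complete_graph 2) = {0, 1}"
  "verts (path_graph 4) = {0, 1, 2, 3}" "verts (cycle_graph 4) = {0, 1, 2, 3}"
  by (auto simp: path_graph_def cycle_graph_def complete_graph_def)

lemma edges_small_graphs:
  "edges (complete_graph 1) = {}" "edges (complete_graph 2) = {{0, 1}}"
  "edges (path_graph 4) = {{0, 1}, {1, 2}, {2, 3}}"
  "edges (cycle_graph 4) = {{0, 1}, {1, 2}, {2, 3}, {3, 0}}"
proof -
  have lessThan: "{..<1} = {0 :: nat}" "{..<2} = {0, 1 :: nat}" "{..<3} = {0, 1, 2 :: nat}"
    "{..<4} = {0, 1, 2, 3 :: nat}"
    by auto
  show "edges (complete_graph 1) = {}" "edges (complete_graph 2) = {{0, 1}}"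
    unfolding complete_graph_def lessThan by (simp_all add: nsets_eq_empty)
  have "edges (path_graph 4) = (\<lambda>i. {i, Suc i}) ` {..<3}"
    unfolding path_graph_def by auto
  then show "edges (path_graph 4) = {{0, 1}, {1, 2}, {2, 3}}"
    unfolding lessThan by (simp add: numeral_eq_Suc)
  have "edges (cycle_graph 4) = (\<lambda>i. {i, (i + 1) mod 4}) ` {..<4}"
    unfolding cycle_graph_def by auto
  then show "edges (cycle_graph 4) = {{0, 1}, {1, 2}, {2, 3}, {3, 0}}"
    unfolding lessThan by (simp del: One_nat_def)
qed

lemma verts_N5:
  "verts N5_1 = {Inl 0, Inr (Inl 0), Inr (Inl 1), Inr (Inr 0), Inr (Inr 1)}"
  "verts N5_2 = {Inl 0, Inr 0, Inr 1, Inr 2, Inr 3}"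
  "verts N5_3 = {Inl 0, Inr 0, Inr 1, Inr 2, Inr 3}"
  by (auto simp: N5_1_def N5_2_def N5_3_def join_def disjoint_union_def Plus_def
      verts_small_graphs simp del: One_nat_def)

lemma edges_N5:
  "edges N5_1 = {{Inl 0, Inr (Inl 0)}, {Inl 0, Inr (Inl 1)}, {Inl 0, Inr (Inr 0)}, {Inl 0, Inr (Inr 1)},
     {Inr (Inl 0), Inr (Inl 1)}, {Inr (Inr 0), Inr (Inr 1)}}"
  "edges N5_2 = {{Inl 0, Inr 0}, {Inl 0, Inr 1}, {Inl 0, Inr 2}, {Inl 0, Inr 3},
     {Inr 0, Inr 1}, {Inr 1, Inr 2}, {Inr 2, Inr 3}}"
  "edges N5_3 = {{Inl 0, Inr 0}, {Inl 0, Inr 1}, {Inl 0, Inr 2}, {Inl 0, Inr 3},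
     {Inr 0, Inr 1}, {Inr 1, Inr 2}, {Inr 2, Inr 3}, {Inr 3, Inr 0}}"
proof -
  have join1: "edges (join (complete_graph 1) H) =
      (\<lambda>v. {Inl 0, Inr v}) ` verts H \<union> (`) Inr ` edges H" for H :: "'b ugraph"
    unfolding join_def edges_small_graphs verts_small_graphs by auto
  show "edges N5_1 = {{Inl 0, Inr (Inl 0)}, {Inl 0, Inr (Inl 1)}, {Inl 0, Inr (Inr 0)}, {Inl 0, Inr (Inr 1)},
     {Inr (Inl 0), Inr (Inl 1)}, {Inr (Inr 0), Inr (Inr 1)}}"
    unfolding N5_1_def join1 disjoint_union_def
    by (auto simp: Plus_def verts_small_graphs edges_small_graphs simp del: One_nat_def)
  show "edges N5_2 = {{Inl 0, Inr 0}, {Inl 0, Inr 1}, {Inl 0, Inr 2}, {Inl 0, Inr 3},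
     {Inr 0, Inr 1}, {Inr 1, Inr 2}, {Inr 2, Inr 3}}"
    unfolding N5_2_def join1 verts_small_graphs edges_small_graphs by auto
  show "edges N5_3 = {{Inl 0, Inr 0}, {Inl 0, Inr 1}, {Inl 0, Inr 2}, {Inl 0, Inr 3},
     {Inr 0, Inr 1}, {Inr 1, Inr 2}, {Inr 2, Inr 3}, {Inr 3, Inr 0}}"
    unfolding N5_3_def join1 verts_small_graphs edges_small_graphs by auto
qed

text \<open>The ten equivalences cover the pairs of distinct vertices. \<open>graph_iso\<close> also
  compares \<open>{u, u}\<close>, which the exclusion of singletons settles.\<close>

lemma graph_iso_5I:
  assumes "verts H = {e, a, b, c, d}" "distinct [e, a, b, c, d]" "\<And>x. {x} \<notin> edges H"
    and "verts K = {e', a', b', c', d'}" "distinct [e', a', b', c', d']" "\<And>x. {x} \<notin> edges K"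
    and "{e, a} \<in> edges H \<longleftrightarrow> {e', a'} \<in> edges K" "{e, b} \<in> edges H \<longleftrightarrow> {e', b'} \<in> edges K"
    and "{e, c} \<in> edges H \<longleftrightarrow> {e', c'} \<in> edges K" "{e, d} \<in> edges H \<longleftrightarrow> {e', d'} \<in> edges K"
    and "{a, b} \<in> edges H \<longleftrightarrow> {a', b'} \<in> edges K" "{a, c} \<in> edges H \<longleftrightarrow> {a', c'} \<in> edges K"
    and "{a, d} \<in> edges H \<longleftrightarrow> {a', d'} \<in> edges K" "{b, c} \<in> edges H \<longleftrightarrow> {b', c'} \<in> edges K"
    and "{b, d} \<in> edges H \<longleftrightarrow> {b', d'} \<in> edges K" "{c, d} \<in> edges H \<longleftrightarrow> {c', d'} \<in> edges K"
  shows "graph_iso H K"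
proof -
  define f where
    "f = (\<lambda>x. if x = e then e' else if x = a then a' else if x = b then b'
           else if x = c then c' else d')"
  have f: "f e = e'" "f a = a'" "f b = b'" "f c = c'" "f d = d'"
    using assms(2) by (auto simp: f_def)
  have "bij_betw f (verts H) (verts K)"
    unfolding assms(1,4) bij_betw_def inj_on_def using assms(2,5) by (simp add: f) metis
  moreover have "\<forall>u \<in> verts H. \<forall>v \<in> verts H. {u, v} \<in> edges H \<longleftrightarrow> {f u, f v} \<in> edges K"
    unfolding assms(1) using assms(3,6-) by (simp add: f insert_commute)
  ultimately show ?thesis
    unfolding graph_iso_def by blast
qed

text \<open>The apex is \<open>e\<close>; the rim has edges \<open>ab\<close> and \<open>cd\<close>,
  joined by \<open>bc\<close> to the path \<open>a, b, c, d\<close>, which \<open>ad\<close> closes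
  to a 4-cycle.\<close>

lemma graph_iso_N5:
  assumes "verts H = {e, a, b, c, d}" "distinct [e, a, b, c, d]" "\<And>x. {x} \<notin> edges H"
    and "{e, a} \<in> edges H" "{e, b} \<in> edges H" "{e, c} \<in> edges H" "{e, d} \<in> edges H"
    and "{a, b} \<in> edges H" "{c, d} \<in> edges H" "{a, c} \<notin> edges H" "{b, d} \<notin> edges H"
  shows "{b, c} \<notin> edges H \<Longrightarrow> {a, d} \<notin> edges H \<Longrightarrow> graph_iso H N5_1"
    and "{b, c} \<in> edges H \<Longrightarrow> {a, d} \<notin> edges H \<Longrightarrow> graph_iso H N5_2"
    and "{b, c} \<in> edges H \<Longrightarrow> {a, d} \<in> edges H \<Longrightarrow> graph_iso H N5_3"
  subgoal
    using assms
    by (intro graph_iso_5I[OF assms(1-3) verts_N5(1)])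
      (auto simp: edges_N5 doubleton_eq_iff)
  subgoal
    using assms
    by (intro graph_iso_5I[OF assms(1-3) verts_N5(2)])
      (auto simp: edges_N5 doubleton_eq_iff)
  subgoal
    using assms
    by (intro graph_iso_5I[OF assms(1-3) verts_N5(3)])
      (auto simp: edges_N5 doubleton_eq_iff)
  done

section \<open>Neighbourhoods of vertices of degree 5\<close>

lemma minimal_ramsey33_degree_5:
  assumes "simple_graph G" "minimal_ramsey33 G" "v \<in> verts G" "clique_number G \<le> 4"
    and deg: "degree G v = 5"
  shows "graph_iso (neighbourhood_graph G v) N5_1 \<or>
    graph_iso (neighbourhood_graph G v) N5_2 \<or>
    graph_iso (neighbourhood_graph G v) N5_3"
proof -
  let ?N = "neighbours G v" and ?E = "edges G" and ?H = "neighbourhood_graph G v"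
  have fin: "finite ?N" using deg by (simp add: degree_def card_ge_0_finite)
  \<comment> \<open>Otherwise the four neighbours other than \<open>x\<close> would form a
    \<open>K_5\<close> with \<open>v\<close>.\<close>
  have nonedge_avoiding: "\<exists>p q. p \<in> ?N \<and> q \<in> ?N \<and> distinct [x, p, q] \<and> {p, q} \<notin> ?E" if "x \<in> ?N" for x
  proof -
    have "\<not> clique (?N - {x}) ?E"
      using card_clique_neighbours[OF assms(1,3), of "?N - {x}"] assms(4) deg that by (auto simp: degree_def)
    then show ?thesis by (auto simp: clique_def)
  qed
  have no_indep3: "\<not> ({x, y} \<notin> ?E \<and> {x, z} \<notin> ?E \<and> {y, z} \<notin> ?E)"
    if "x \<in> ?N" "y \<in> ?N" "z \<in> ?N" "distinct [x, y, z]" for x y z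
  proof
    assume "{x, y} \<notin> ?E \<and> {x, z} \<notin> ?E \<and> {y, z} \<notin> ?E"
    then have "indep {x, y, z} ?E"
      by (auto simp: indep_def insert_commute)
    then show False
      using minimal_ramsey33_indep_neighbours[OF assms(1-3), of "{x, y, z}"] that deg by simp
  qed
  \<comment> \<open>If any two nonedges meet, take a nonedge \<open>ab\<close>. One avoiding
    \<open>a\<close> has the form \<open>bp\<close>, one avoiding \<open>b\<close> the form
    \<open>at\<close>; these meet only if \<open>t = p\<close>, and then \<open>a, b, p\<close> are
    independent.\<close>
  have "\<exists>a b c d. {a, b, c, d} \<subseteq> ?N \<and> distinct [a, b, c, d] \<and> {a, b} \<notin> ?E \<and> {c, d} \<notin> ?E"
  proof (rule ccontr)
    assume "\<not> ?thesis"
    then have no: "\<not> (distinct [a, b, c, d] \<and> {a, b} \<notin> ?E \<and> {c, d} \<notin> ?E)"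
      if "a \<in> ?N" "b \<in> ?N" "c \<in> ?N" "d \<in> ?N" for a b c d
      using that by simp
    have "?N \<noteq> {}" using deg by (auto simp: degree_def)
    then obtain a b where ab: "a \<in> ?N" "b \<in> ?N" "a \<noteq> b" "{a, b} \<notin> ?E"
      using nonedge_avoiding by fastforce
    obtain q r where qr: "q \<in> ?N" "r \<in> ?N" "distinct [a, q, r]" "{q, r} \<notin> ?E"
      using nonedge_avoiding[OF ab(1)] by blast
    have "q = b \<or> r = b"
      using no[of a b q r] ab qr by auto
    then obtain p where p: "p \<in> ?N" "p \<noteq> a" "p \<noteq> b" "{b, p} \<notin> ?E"
      using qr by (auto simp: insert_commute)
    obtain r s where rs: "r \<in> ?N" "s \<in> ?N" "distinct [b, r, s]" "{r, s} \<notin> ?E"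
      using nonedge_avoiding[OF ab(2)] by blast
    have "r = a \<or> s = a"
      using no[of a b r s] ab rs by auto
    then obtain t where t: "t \<in> ?N" "t \<noteq> a" "t \<noteq> b" "{a, t} \<notin> ?E"
      using rs by (auto simp: insert_commute)
    show False
      using no[of a t b p] no_indep3[of a b p] ab p t by auto
  qed
  then obtain a b c d where abcd: "{a, b, c, d} \<subseteq> ?N" "distinct [a, b, c, d]"
    and ab: "{a, b} \<notin> ?E" and cd: "{c, d} \<notin> ?E" by blast
  have "card (?N - {a, b, c, d}) = 1"
    using abcd deg fin by (simp add: degree_def card_Diff_subset)
  then obtain e where "?N - {a, b, c, d} = {e}"
    by (auto simp: card_1_singleton_iff)
  then have N: "?N = {e, a, b, c, d}" and dist: "distinct [e, a, b, c, d]"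
    using abcd by auto
  \<comment> \<open>If \<open>qr\<close> were a nonedge too, \<open>p, q, r\<close> would span at
    most the edge \<open>pr\<close>, and \<open>{x, y}\<close> is independent: a forbidden
    split.\<close>
  have adj: "{q, r} \<in> ?E"
    if "?N = {x, y, p, q, r}" "distinct [x, y, p, q, r]" "{x, y} \<notin> ?E" "{p, q} \<notin> ?E" for x y p q r
  proof (rule ccontr)
    assume "{q, r} \<notin> ?E"
    have N': "?N - {x, y} = {p, q, r}" using that(1,2) by auto
    have "indep {x, y} ?E"
      using that(3) by (auto simp: indep_def insert_commute)
    then show False
    proof (rule minimal_ramsey33_no_split[OF assms(1-3)])
      fix u w
      assume "u \<in> ?N - {x, y}" "w \<in> ?N - {x, y}" "{u, w} \<in> ?E"
      then show "{u, w} = {p, r}"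
        unfolding N' using that(4) \<open>{q, r} \<notin> ?E\<close> graph_not_loop[OF assms(1)]
        by (auto simp: insert_commute)
    qed
  qed
  \<comment> \<open>Each of the four vertices takes the role of \<open>q\<close>, with its partner
    as \<open>p\<close> and the other nonedge as \<open>xy\<close>; so \<open>e\<close> is the
    apex.\<close>
  have e: "{a, e} \<in> ?E" "{b, e} \<in> ?E" "{c, e} \<in> ?E" "{d, e} \<in> ?E"
    using adj[of c d b a e] adj[of c d a b e] adj[of a b d c e] adj[of a b c d e] N dist ab cd
    by (auto simp: insert_commute)
  have H: "verts ?H = ?N" "\<And>x y. {x, y} \<in> edges ?H \<longleftrightarrow> {x, y} \<in> ?E \<and> x \<in> ?N \<and> y \<in> ?N"
    using neighbours_subset[of G v] by (auto simp: neighbourhood_graph_def induced_def)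
  \<comment> \<open>The last condition excludes only the path \<open>y, x, w, z\<close>, which is
    reached by another labelling.\<close>
  have iso: ?thesis
    if "?N = {e, x, y, z, w}" "distinct [e, x, y, z, w]" "{x, z} \<notin> ?E" "{y, w} \<notin> ?E"
      "{x, y} \<in> ?E" "{z, w} \<in> ?E" "{y, z} \<in> ?E \<or> {x, w} \<notin> ?E" for x y z w
  proof -
    have "{e, x} \<in> ?E" "{e, y} \<in> ?E" "{e, z} \<in> ?E" "{e, w} \<in> ?E"
      using e that(1,2) N dist by (auto simp: insert_commute)
    moreover have "{u} \<notin> edges ?H" for u
      using H(2)[of u u] graph_not_loop[OF assms(1)] by auto
    ultimately show ?thesis
      using graph_iso_N5[of ?H e x y z w] that by (auto simp: H)
  qed
  \<comment> \<open>Without independent triples, every vertex of one nonedge is adjacent to an end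
    of the other; so one of the two perfect matchings between them consists of edges.\<close>
  have "{a, c} \<in> ?E \<and> {b, d} \<in> ?E \<or> {a, d} \<in> ?E \<and> {b, c} \<in> ?E"
    using no_indep3[of a b c] no_indep3[of a b d] no_indep3[of c d a] no_indep3[of c d b] abcd ab cd
    by (auto simp: insert_commute)
  \<comment> \<open>Each matching admits two labellings that exchange \<open>yz\<close> and
    \<open>xw\<close>, and at least one of them meets the last condition of
    \<open>iso\<close>.\<close>
  then show ?thesis
    using iso[of a c b d] iso[of c a d b] iso[of a d b c] iso[of d a c b] N dist ab cd
    by (auto simp: insert_commute)
qed

theorem theorem8p1:
  fixes G :: "'a ugraph"
  assumes "simple_graph G"
    and "minimal_ramsey33 G"
    and "clique_number G \<le> 4"
  shows "min_degree G \<ge> 5 \<and>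
    (\<forall>v \<in> verts G. degree G v = 5 \<longrightarrow>
      graph_iso (neighbourhood_graph G v) N5_1 \<or>
      graph_iso (neighbourhood_graph G v) N5_2 \<or>
      graph_iso (neighbourhood_graph G v) N5_3)"
proof
  \<comment> \<open>A graph without vertices has no triangle, hence is not Ramsey; so the minimum is
    over a nonempty set.\<close>
  have "verts G \<noteq> {}"
    using assms(2) by (auto simp: minimal_ramsey33_def ramsey33_def nsets_def)
  then show "min_degree G \<ge> 5"
    unfolding min_degree_def
    using minimal_ramsey33_degree_ge_5[OF assms(1,2) _ assms(3)] graph_finite_verts[OF assms(1)]
    by (subst Min_ge_iff) auto
next
  show "\<forall>v \<in> verts G. degree G v = 5 \<longrightarrow>
      graph_iso (neighbourhood_graph G v) N5_1 \<or>
      graph_iso (neighbourhood_graph G v) N5_2 \<or>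
      graph_iso (neighbourhood_graph G v) N5_3"
    using minimal_ramsey33_degree_5[OF assms(1,2) _ assms(3)] by blast
qed

end
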